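(* Let $A\in\mathbb{R}^{m\times n}$ and $b\in\mathbb{R}^m$ with $m>n$, and let $L\in\mathbb{R}^{n\times k}$ with $k\le n$. Let $\sigma_1\ge\dots\ge\sigma_{n+1}$ be the singular values of $[A,b]$ and $\sigma'_1\ge\dots\ge\sigma'_n$ those of $A$, and assume the genericity condition $\sigma'_n>\sigma_{n+1}$. Let $x$ be the total least squares solution. Then the condition number $K(L,A,b)$ of $L^Tx$ (defined in the context) satisfies $K(L,A,b)\le \bar K(L,A,b)$, where $$\bar K(L,A,b)=(1+\|x\|_2^2)^{1/2}\,\|L\|_2\,\frac{(\sigma_1^2+\sigma_{n+1}^2)^{1/2}}{\sigma_n'^2-\sigma_{n+1}^2}.$$
   Context: The total least squares (TLS) problem is $\min_{E,\epsilon}\|(E,\epsilon)\|_F$ subject to $(A+E)x=b+\epsilon$; under the genericity condition $\sigma'_n>\sigma_{n+1}$ its solution $x$ exists, is unique, and equals $x=(A^TA-\lambda_{n+1}I_n)^{-1}A^Tb$, where $\lambda_{n+1}=\sigma_{n+1}^2$. The mapping $g$ is $g(A,b)=L^Tx=L^T(A^TA-\lambda_{n+1}I_n)^{-1}A^Tb\in\mathbb{R}^k$, where $\lambda_{n+1}=\lambda_{n+1}(A,b)$ is regarded as a function of $(A,b)$ (the smallest eigenvalue of $[A,b]^T[A,b]$); $L$ is fixed. The genericity condition is open, so $g$ is defined in a neighborhood of $(A,b)$ in $\mathbb{R}^{m\times n}\times\mathbb{R}^m$, and it is Fréchet differentiable there. Data are measured with the norm $\|(\Delta A,\Delta b)\|_F=\sqrt{\|\Delta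 A\|_F^2+\|\Delta b\|_2^2}$, and the (absolute) condition number is $$K(L,A,b)=\max_{(\Delta A,\Delta b)\neq 0}\frac{\|g'(A,b).(\Delta A,\Delta b)\|_2}{\|(\Delta A,\Delta b)\|_F}.$$ For matrices, $\|\cdot\|_2$ is the spectral norm. *)

theory Defs
  imports "HOL-Analysis.Analysis" "HOL-Computational_Algebra.Polynomial"
begin

text \<open>
  The norm of \<^typ>\<open>real^'n^'m\<close> is the Euclidean norm of the vector of row norms, that is, the
  Frobenius norm, and the product norm on \<^typ>\<open>(real^'n^'m) \<times> (real^'m)\<close> is the square root of the
  sum of the squares of both norms. Hence \<^term>\<open>norm (E, e)\<close> is the Frobenius norm of the
  pair, and no norm on matrices has to be introduced. The spectral norm of a matrix \<open>L\<close> is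
  \<^term>\<open>onorm (\<lambda>v. L *v v)\<close>.
\<close>

definition augment :: "real^'n^'m \<Rightarrow> real^'m \<Rightarrow> real^('n + 1)^'m" where
  "augment A b = (\<chi> i j. case j of Inl p \<Rightarrow> A $ i $ p | Inr _ \<Rightarrow> b $ i)"

definition real_eigenvalues :: "real^'n^'n \<Rightarrow> real set" where
  "real_eigenvalues M = {l. \<exists>v. v \<noteq> 0 \<and> M *v v = l *\<^sub>R v}"

definition charpoly_real :: "real^'n^'n \<Rightarrow> real poly" where
  "charpoly_real M = det (\<chi> i j. (if i = j then [:0, 1:] else 0) - [:M $ i $ j:])"

text \<open>
  \<open>s 1 \<ge> \<dots> \<ge> s n \<ge> 0\<close> are the singular values of an \<open>m \<times> n\<close> matrix \<open>M\<close>, repeated according to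
  multiplicity: their squares are the eigenvalues of \<open>M\<^sup>T M\<close>, counted as roots of the
  characteristic polynomial. This is the usual list for \<open>m \<ge> n\<close>; for \<open>m < n\<close> it is
  padded with zeros. Values of \<open>s\<close> outside \<open>{1..n}\<close> are irrelevant.
\<close>

definition singular_values :: "real^'n^'m \<Rightarrow> (nat \<Rightarrow> real) \<Rightarrow> bool" where
  "singular_values M s \<longleftrightarrow>
     (\<forall>i\<in>{1..CARD('n)}. 0 \<le> s i) \<and>
     (\<forall>i\<in>{1..CARD('n)}. \<forall>j\<in>{1..CARD('n)}. i \<le> j \<longrightarrow> s j \<le> s i) \<and>
     charpoly_real (transpose M ** M) = (\<Prod>i=1..CARD('n). [:- ((s i)\<^sup>2), 1:])"

definition tls_solution :: "real^'n^'m \<Rightarrow> real^'m \<Rightarrow> real^'n \<Rightarrow> bool" where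
  "tls_solution A b x \<longleftrightarrow>
     (\<exists>E e. (A + E) *v x = b + e \<and>
        (\<forall>E' e' x'. (A + E') *v x' = b + e' \<longrightarrow> norm (E, e) \<le> norm (E', e')))"

definition tls_lambda :: "real^'n^'m \<Rightarrow> real^'m \<Rightarrow> real" where
  "tls_lambda A b = Min (real_eigenvalues (transpose (augment A b) ** augment A b))"

definition tls_map :: "real^'k^'n \<Rightarrow> (real^'n^'m) \<times> (real^'m) \<Rightarrow> real^'k" where
  "tls_map L = (\<lambda>(A, b).
     transpose L *v
       (matrix_inv (transpose A ** A - tls_lambda A b *\<^sub>R mat 1) *v (transpose A *v b)))"

text \<open>
  The supremum is a maximum, since the derivative is a linear map between finite-dimensional spaces.
\<close>

definition tls_cond :: "real^'k^'n \<Rightarrow> real^'n^'m \<Rightarrow> real^'m \<Rightarrow> real" where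
  "tls_cond L A b =
     (SUP d\<in>{d. d \<noteq> 0}. norm (frechet_derivative (tls_map L) (at (A, b)) d) / norm d)"

end

(*
  Let M = [A, b], z = (x, -1), r = A x - b and let l be the smallest eigenvalue of M^T M. The
  minimizer of the Rayleigh quotient of M^T M has a nonzero last component, by the gap between A
  and M, and is thus proportional to z, that is, A^T r = l x and b . r = - l. Pairing the
  eigenvector equations at (A, b) and at a nearby point (A', b') gives
    (l' - l) (1 + x . x') = (dA x - db) . r' + r . (dA x' - db),
    (A^T A - l I) (x' - x) = (l' - l) x' - A^T (dA x' - db) - dA^T r',
  and as l' and x' are continuous, both are differentiable. No smoothness theory of eigenvalues
  is needed. With D = [dA, db] the derivative of x satisfies (A^T A - l I) dx = - u, where u
  consists of the first n components of
    M^T D z + D^T M z - 2 ((M z) . (D z)) / |z|^2 z,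
  whose norm is at most |z| sqrt (s^2 + l) |D| with s the largest singular value of M. The
  smallest eigenvalue of A^T A - l I is the denominator of the bound.
*)

theory Submission
  imports Defs
begin

section \<open>Singular values and Rayleigh quotients\<close>

lemma inner_transpose_matrix_vector:
  fixes M :: "real^'n^'m"
  shows "(transpose M *v s) \<bullet> v = s \<bullet> (M *v v)"
  by (metis dot_lmul_matrix vector_transpose_matrix transpose_transpose)

lemma inner_gram:
  fixes M :: "real^'n^'m"
  shows "u \<bullet> ((transpose M ** M) *v v) = (M *v u) \<bullet> (M *v v)"
  by (metis inner_commute inner_transpose_matrix_vector matrix_vector_mul_assoc)

lemma norm_matrix_vector_le:
  fixes M :: "real^'n^'m"
  shows "norm (M *v v) \<le> norm M * norm v"
proof -
  have "norm (M *v v) = L2_set (\<lambda>i. norm (M $ i \<bullet> v)) UNIV"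
    by (simp add: norm_vec_def matrix_vector_mult_def inner_vec_def)
  also have "\<dots> \<le> L2_set (\<lambda>i. norm (M $ i) * norm v) UNIV"
    by (intro L2_set_mono) (auto simp: Cauchy_Schwarz_ineq2)
  also have "\<dots> = norm M * norm v"
    by (simp add: norm_vec_def L2_set_right_distrib [symmetric] L2_set_left_distrib)
  finally show ?thesis .
qed

text \<open>Pair the image \<open>u = transpose M *v s\<close> with itself and move one factor
  across: the square of its norm is \<open>s \<bullet> (M *v u)\<close>, to which Cauchy-Schwarz and
  the bound for \<open>M\<close> apply.\<close>

lemma norm_transpose_matrix_vector_le:
  fixes M :: "real^'n^'m"
  assumes "\<And>v. norm (M *v v) \<le> c * norm v"
  shows "norm (transpose M *v s) \<le> c * norm s"
proof (cases "transpose M *v s = 0")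
  case True
  \<comment> \<open>The sign of \<open>c\<close> is not given; testing the assumed bound on a unit
    vector supplies it.\<close>
  have "0 \<le> c * norm (axis undefined 1 :: real^'n)"
    using assms norm_ge_zero order_trans by blast
  then show ?thesis using True by simp
next
  case False
  let ?u = "transpose M *v s"
  have "norm ?u * norm ?u = s \<bullet> (M *v ?u)"
    using inner_transpose_matrix_vector[of M s ?u]
    by (simp add: power2_norm_eq_inner power2_eq_square[symmetric])
  also have "\<dots> \<le> norm s * (c * norm ?u)"
    by (meson assms norm_cauchy_schwarz mult_left_mono norm_ge_zero order_trans)
  finally have "norm ?u * norm ?u \<le> (c * norm s) * norm ?u"
    by (simp add: mult_ac)
  then show ?thesis using False by simp
qed

text \<open>The form \<open>Q\<close> of N - \<mu> I is nonnegative and vanishes at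
  \<open>z\<close>, so its first variation at \<open>z\<close> is zero. In the direction of the
  eigenvector residual \<open>w\<close> that variation is twice the square of the norm of
  \<open>w\<close>.\<close>

lemma symmetric_min_eigenvector:
  fixes N :: "real^'n^'n"
  assumes sym: "\<And>u v. u \<bullet> (N *v v) = v \<bullet> (N *v u)"
    and lower: "\<And>v. \<mu> * (norm v)\<^sup>2 \<le> v \<bullet> (N *v v)"
    and eq: "z \<bullet> (N *v z) = \<mu> * (norm z)\<^sup>2"
  shows "N *v z = \<mu> *\<^sub>R z"
proof -
  define w where "w = N *v z - \<mu> *\<^sub>R z"
  define Q where "Q v = v \<bullet> (N *v v) - \<mu> * (v \<bullet> v)" for v
  have Q0: "0 \<le> Q v" for v
    using lower[of v] by (simp add: Q_def power2_norm_eq_inner)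
  have exp: "Q (z + t *\<^sub>R w) = 2 * t * (w \<bullet> w) + t\<^sup>2 * Q w" for t
  proof -
    have "Q (z + t *\<^sub>R w) = Q z + 2 * t * (w \<bullet> (N *v z) - \<mu> * (w \<bullet> z)) + t\<^sup>2 * Q w"
      using sym[of z w]
      by (simp add: Q_def matrix_vector_right_distrib scaleR_matrix_vector_assoc [symmetric]
          matrix_vector_mult_scaleR inner_add_left inner_add_right inner_commute[of z w]
          power2_eq_square algebra_simps)
    moreover have "Q z = 0" using eq by (simp add: Q_def power2_norm_eq_inner)
    moreover have "w \<bullet> (N *v z) - \<mu> * (w \<bullet> z) = w \<bullet> w"
      by (simp add: w_def inner_diff_right)
    ultimately show ?thesis by simp
  qed
  have "w \<bullet> w = 0"
  proof (rule ccontr)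
    assume "w \<bullet> w \<noteq> 0"
    then have pos: "w \<bullet> w > 0" using inner_ge_zero[of w] by linarith
    \<comment> \<open>This minimizes the quadratic with \<open>Q w + 1\<close> in place of
      \<open>Q w\<close>; the added 1 keeps the denominator positive when
      \<open>Q w = 0\<close>.\<close>
    define t where "t = - (w \<bullet> w) / (Q w + 1)"
    have "Q w + 1 > 0" using Q0[of w] by simp
    have "0 \<le> 2 * t * (w \<bullet> w) + t\<^sup>2 * Q w" using Q0 exp by metis
    also have "\<dots> \<le> 2 * t * (w \<bullet> w) + t\<^sup>2 * (Q w + 1)" by (simp add: algebra_simps)
    also have "\<dots> = - ((w \<bullet> w)\<^sup>2 / (Q w + 1))"
    proof -
      have "t * (Q w + 1) = - (w \<bullet> w)" using \<open>Q w + 1 > 0\<close> by (simp add: t_def)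
      then have "t\<^sup>2 * (Q w + 1) = - (t * (w \<bullet> w))"
        by (simp add: power2_eq_square mult.assoc)
      moreover have "t * (w \<bullet> w) = - ((w \<bullet> w)\<^sup>2 / (Q w + 1))"
        by (simp add: t_def power2_eq_square)
      ultimately show ?thesis by simp
    qed
    also have "\<dots> < 0" using pos \<open>Q w + 1 > 0\<close> by simp
    finally show False by simp
  qed
  then show ?thesis by (simp add: w_def)
qed

text \<open>The quadratic form attains its minimum on the compact unit sphere, homogeneity extends
  the bound to all vectors, and a minimizer is an eigenvector.\<close>

lemma symmetric_min_eigenvalue_exists:
  fixes N :: "real^'n^'n"
  assumes sym: "\<And>u v. u \<bullet> (N *v v) = v \<bullet> (N *v u)"
  obtains \<mu> z where "norm z = 1" "N *v z = \<mu> *\<^sub>R z"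
    "\<And>v. \<mu> * (norm v)\<^sup>2 \<le> v \<bullet> (N *v v)"
proof -
  have "axis undefined 1 \<in> sphere (0::real^'n) 1" by simp
  then have "sphere (0::real^'n) 1 \<noteq> {}" by blast
  then obtain z :: "real^'n" where z: "norm z = 1"
    and min: "\<And>v. norm v = 1 \<Longrightarrow> z \<bullet> (N *v z) \<le> v \<bullet> (N *v v)"
    using continuous_attains_inf[of "sphere (0::real^'n) 1" "\<lambda>v. v \<bullet> (N *v v)"]
    by (force intro!: continuous_intros)
  define \<mu> where "\<mu> = z \<bullet> (N *v z)"
  have lower: "\<mu> * (norm v)\<^sup>2 \<le> v \<bullet> (N *v v)" for v
  proof (cases "v = 0")
    case False
    have "\<mu> \<le> (v /\<^sub>R norm v) \<bullet> (N *v (v /\<^sub>R norm v))"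
      unfolding \<mu>_def by (rule min) (simp add: False)
    also have "\<dots> = (v \<bullet> (N *v v)) / (norm v)\<^sup>2"
      by (simp add: matrix_vector_mult_scaleR power2_eq_square divide_simps)
    finally show ?thesis using False by (simp add: field_simps)
  qed simp
  have "N *v z = \<mu> *\<^sub>R z"
    by (rule symmetric_min_eigenvector[OF sym lower]) (simp add: z \<mu>_def)
  then show thesis using that z lower by blast
qed

text \<open>Eigenvectors for distinct eigenvalues are orthogonal, hence independent. Finiteness is
  what gives the \<open>Min\<close> in \<open>tls_lambda\<close> its meaning.\<close>

lemma finite_real_eigenvalues:
  fixes N :: "real^'n^'n"
  assumes sym: "\<And>u v. u \<bullet> (N *v v) = v \<bullet> (N *v u)"
  shows "finite (real_eigenvalues N)"
proof -
  define f where "f l = (SOME v. v \<noteq> 0 \<and> N *v v = l *\<^sub>R v)" for l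
  have f: "f l \<noteq> 0" "N *v f l = l *\<^sub>R f l" if "l \<in> real_eigenvalues N" for l
    using that someI_ex[of "\<lambda>v. v \<noteq> 0 \<and> N *v v = l *\<^sub>R v"]
    by (auto simp: real_eigenvalues_def f_def)
  have orth: "f l \<bullet> f k = 0"
    if "l \<in> real_eigenvalues N" "k \<in> real_eigenvalues N" "l \<noteq> k" for l k
    using sym[of "f l" "f k"] f that by (simp add: inner_commute)
  have inj: "inj_on f (real_eigenvalues N)"
    by (rule inj_onI) (metis f(1) orth inner_eq_zero_iff)
  have "independent (f ` real_eigenvalues N)"
  proof (rule pairwise_orthogonal_independent)
    show "pairwise orthogonal (f ` real_eigenvalues N)"
      using orth by (force simp: pairwise_def orthogonal_def)
    show "0 \<notin> f ` real_eigenvalues N"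
      using f(1) by force
  qed
  then show ?thesis
    using inj finite_imageD independent_bound by blast
qed

lemma gram_symmetric:
  fixes M :: "real^'n^'m"
  shows "u \<bullet> ((transpose M ** M) *v v) = v \<bullet> ((transpose M ** M) *v u)"
  by (simp add: inner_gram inner_commute)

text \<open>The minimal Rayleigh quotient is an eigenvalue, and every eigenvalue is the quotient of
  its eigenvector, so \<open>Min\<close> picks exactly this minimum.\<close>

lemma gram_min_eigenvalue:
  fixes M :: "real^'n^'m"
  defines "\<mu> \<equiv> Min (real_eigenvalues (transpose M ** M))"
  shows "\<mu> \<in> real_eigenvalues (transpose M ** M)"
    and "\<mu> * (norm v)\<^sup>2 \<le> (norm (M *v v))\<^sup>2"
    and "0 \<le> \<mu>"
proof -
  let ?N = "transpose M ** M"
  obtain \<nu> z where z: "norm z = 1" "?N *v z = \<nu> *\<^sub>R z"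
    and lower: "\<And>v. \<nu> * (norm v)\<^sup>2 \<le> v \<bullet> (?N *v v)"
    using symmetric_min_eigenvalue_exists[OF gram_symmetric[of _ M]] by metis
  have fin: "finite (real_eigenvalues ?N)"
    by (rule finite_real_eigenvalues) (rule gram_symmetric)
  have mem: "\<nu> \<in> real_eigenvalues ?N"
    unfolding real_eigenvalues_def using z by (intro CollectI exI[of _ z]) auto
  have "\<nu> \<le> l" if l: "l \<in> real_eigenvalues ?N" for l
  proof -
    obtain u where u: "u \<noteq> 0" "?N *v u = l *\<^sub>R u"
      using l by (auto simp: real_eigenvalues_def)
    then have "\<nu> * (norm u)\<^sup>2 \<le> l * (norm u)\<^sup>2"
      using lower[of u] by (simp add: power2_norm_eq_inner)
    then show ?thesis using u(1) by simp
  qed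
  then have "\<mu> = \<nu>" unfolding \<mu>_def using fin mem by (intro Min_eqI) auto
  moreover have "\<nu> = (norm (M *v z))\<^sup>2"
    using inner_gram[of z M z] z by (simp add: power2_norm_eq_inner norm_eq_1)
  ultimately show "\<mu> \<in> real_eigenvalues ?N" "0 \<le> \<mu>"
    "\<mu> * (norm v)\<^sup>2 \<le> (norm (M *v v))\<^sup>2"
    using mem lower[of v] by (auto simp: inner_gram power2_norm_eq_inner)
qed

section \<open>Singular values as roots of the characteristic polynomial\<close>

lemma poly_charpoly_real: "poly (charpoly_real M) l = det (l *\<^sub>R mat 1 - M)"
proof -
  have "poly ((if i = j then [:0, 1:] else 0) - [:M $ i $ j:]) l = (l *\<^sub>R mat 1 - M) $ i $ j" for i j
    by (simp add: mat_def)
  then show ?thesis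
    by (simp add: charpoly_real_def det_def poly_sum poly_prod del: poly_diff)
qed

lemma real_eigenvalues_iff_root: "l \<in> real_eigenvalues M \<longleftrightarrow> poly (charpoly_real M) l = 0"
proof -
  have "l \<in> real_eigenvalues M \<longleftrightarrow> (\<exists>v. v \<noteq> 0 \<and> (l *\<^sub>R mat 1 - M) *v v = 0)"
    by (auto simp: real_eigenvalues_def matrix_vector_mult_diff_rdistrib
        scaleR_matrix_vector_assoc [symmetric])
  also have "\<dots> \<longleftrightarrow> \<not> invertible (l *\<^sub>R mat 1 - M)"
    by (metis invertible_left_inverse matrix_left_invertible_ker)
  finally show ?thesis by (simp add: poly_charpoly_real invertible_det_nz)
qed

lemma real_eigenvalues_gram:
  fixes M :: "real^'n^'m"
  assumes "singular_values M s"
  shows "real_eigenvalues (transpose M ** M) = (\<lambda>i. (s i)\<^sup>2) ` {1..CARD('n)}"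
proof (rule set_eqI)
  fix l
  have "l \<in> real_eigenvalues (transpose M ** M) \<longleftrightarrow>
      poly (\<Prod>i=1..CARD('n). [:- ((s i)\<^sup>2), 1:]) l = 0"
    using assms by (simp add: real_eigenvalues_iff_root singular_values_def)
  also have "\<dots> \<longleftrightarrow> (\<exists>i\<in>{1..CARD('n)}. l = (s i)\<^sup>2)"
    by (simp add: poly_prod)
  finally show "l \<in> real_eigenvalues (transpose M ** M) \<longleftrightarrow> l \<in> (\<lambda>i. (s i)\<^sup>2) ` {1..CARD('n)}"
    by (simp only: image_iff)
qed

lemma singular_values_Min:
  fixes M :: "real^'n^'m"
  assumes s: "singular_values M s"
  shows "Min (real_eigenvalues (transpose M ** M)) = (s CARD('n))\<^sup>2"
  unfolding real_eigenvalues_gram[OF s]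
proof (rule Min_eqI)
  fix y assume "y \<in> (\<lambda>i. (s i)\<^sup>2) ` {1..CARD('n)}"
  then show "(s CARD('n))\<^sup>2 \<le> y"
    using s by (auto simp: singular_values_def intro!: power_mono)
qed (auto simp: Suc_le_eq)

lemma singular_values_lower:
  fixes M :: "real^'n^'m"
  assumes s: "singular_values M s"
  shows "s CARD('n) * norm v \<le> norm (M *v v)"
proof (rule power2_le_imp_le)
  show "(s CARD('n) * norm v)\<^sup>2 \<le> (norm (M *v v))\<^sup>2"
    using gram_min_eigenvalue(2)[of M v] by (simp add: singular_values_Min[OF s] power_mult_distrib)
qed simp

text \<open>The existence of a minimal eigenvalue, applied to the negated Gram matrix, yields the
  largest eigenvalue of the Gram matrix. It is one of the squares, thus at most
  \<open>(s 1)\<^sup>2\<close>.\<close>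

lemma singular_values_upper:
  fixes M :: "real^'n^'m"
  assumes s: "singular_values M s"
  shows "norm (M *v v) \<le> s 1 * norm v"
proof (rule power2_le_imp_le)
  let ?N = "transpose M ** M"
  have minus: "(- ?N) *v v = - (?N *v v)" for v
    using matrix_vector_mult_diff_rdistrib[of 0 ?N v] by simp
  have sym: "u \<bullet> ((- ?N) *v v) = v \<bullet> ((- ?N) *v u)" for u v
    using gram_symmetric[of u M v] by (simp only: minus inner_minus_right)
  obtain \<nu> z where z: "norm z = 1" "(- ?N) *v z = \<nu> *\<^sub>R z"
    and lower: "\<And>v. \<nu> * (norm v)\<^sup>2 \<le> v \<bullet> ((- ?N) *v v)"
    using symmetric_min_eigenvalue_exists[OF sym] by metis
  have "?N *v z = (- \<nu>) *\<^sub>R z" "z \<noteq> 0"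
    using z by (auto simp: minus minus_equation_iff)
  then have "- \<nu> \<in> real_eigenvalues ?N" by (auto simp: real_eigenvalues_def)
  then obtain i where i: "i \<in> {1..CARD('n)}" "- \<nu> = (s i)\<^sup>2"
    unfolding real_eigenvalues_gram[OF s] by blast
  then have "- \<nu> \<le> (s 1)\<^sup>2"
    using s by (auto simp: singular_values_def intro!: power_mono)
  then have "(- \<nu>) * (norm v)\<^sup>2 \<le> (s 1)\<^sup>2 * (norm v)\<^sup>2" by (intro mult_right_mono) auto
  then show "(norm (M *v v))\<^sup>2 \<le> (s 1 * norm v)\<^sup>2"
    using lower[of v] by (simp add: minus inner_gram power2_norm_eq_inner
        power_mult_distrib)
  show "0 \<le> s 1 * norm v" using s by (auto simp: singular_values_def Suc_le_eq)
qed

section \<open>Bordered matrices and the perturbation bound\<close>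

text \<open>Block form (v, t) of a vector over the index type of \<open>augment\<close>; the vector
  (x, -1) on which [A, b] returns the residual is \<open>join x (- 1)\<close>.\<close>

definition join :: "real^'n \<Rightarrow> real \<Rightarrow> real^('n + 1)" where
  "join v t = (\<chi> j. case j of Inl p \<Rightarrow> v $ p | Inr _ \<Rightarrow> t)"

lemma join_cases:
  obtains v t where "z = join v t"
proof
  show "z = join (\<chi> p. z $ Inl p) (z $ Inr 1)"
    by (auto simp: join_def vec_eq_iff split: sum.split)
qed

lemma inner_join: "join u s \<bullet> join v t = u \<bullet> v + s * t"
proof -
  have "(\<Sum>j\<in>UNIV. f j) = (\<Sum>p\<in>UNIV. f (Inl p)) + f (Inr 1)" for f :: "'a + 1 \<Rightarrow> real"
    by (simp add: UNIV_Plus_UNIV [symmetric] sum.Plus del: UNIV_Plus_UNIV)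
  then show ?thesis by (simp add: inner_vec_def join_def)
qed

lemma norm_join: "(norm (join v t))\<^sup>2 = (norm v)\<^sup>2 + t\<^sup>2"
  unfolding power2_norm_eq_inner inner_join power2_eq_square[of t] ..

lemma join_eq_0_iff: "join v t = 0 \<longleftrightarrow> v = 0 \<and> t = 0"
proof -
  have "join v t = 0 \<longleftrightarrow> (norm (join v t))\<^sup>2 = 0" by simp
  then show ?thesis unfolding norm_join by (simp add: add_nonneg_eq_0_iff)
qed

lemma join_eq_iff: "join u s = join v t \<longleftrightarrow> u = v \<and> s = t"
  by (auto simp: join_def vec_eq_iff split: sum.split_asm sum.split)

lemma scaleR_join: "c *\<^sub>R join v t = join (c *\<^sub>R v) (c * t)"
  by (auto simp: join_def vec_eq_iff split: sum.split)

lemma join_add: "join u s + join v t = join (u + v) (s + t)"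
  by (auto simp: join_def vec_eq_iff split: sum.split)

lemma join_diff: "join u s - join v t = join (u - v) (s - t)"
  by (auto simp: join_def vec_eq_iff split: sum.split)

lemma augment_row: "augment A b $ i = join (A $ i) (b $ i)"
  by (simp add: augment_def join_def)

lemma matrix_vector_mult_row: "(B *v u) $ i = (B $ i :: real^'n) \<bullet> u"
  by (simp add: matrix_vector_mult_def inner_vec_def)

lemma augment_join: "augment A b *v join v t = A *v v + t *\<^sub>R b"
  by (simp add: vec_eq_iff matrix_vector_mult_row augment_row inner_join)

lemma transpose_augment: "transpose (augment A b) *v s = join (transpose A *v s) (b \<bullet> s)"
proof (rule vector_eq_ldot[THEN iffD1], rule allI)
  fix z :: "real^('a + 1)"
  obtain v t where z: "z = join v t" by (rule join_cases)
  show "z \<bullet> (transpose (augment A b) *v s) = z \<bullet> join (transpose A *v s) (b \<bullet> s)"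
    unfolding z inner_commute[of "join v t"] inner_transpose_matrix_vector augment_join inner_join
    using inner_transpose_matrix_vector[of A s v]
    by (simp add: inner_add_right inner_commute del: transpose_matrix_vector)
qed

text \<open>Carries bounds for the bordered matrix over to the norm on pairs in which perturbations
  are measured.\<close>

lemma norm_augment: "norm (augment A b) = norm (A, b)"
proof -
  have "(norm (augment A b))\<^sup>2 = (norm (A, b))\<^sup>2"
    by (simp add: power2_norm_eq_inner inner_vec_def[of "augment A b"] augment_row inner_join
        sum.distrib inner_vec_def[of A] inner_vec_def[of b])
  then show ?thesis by simp
qed

lemma augment_diff: "augment A b - augment A' b' = augment (A - A') (b - b')"
  by (simp add: vec_eq_iff[where x = "augment A b - augment A' b'"] augment_row join_diff)

lemma norm_outer_product: "norm ((\<chi> i j. r $ i * y $ j) :: real^'n^'m) = norm (r::real^'m) * norm (y::real^'n)"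
proof -
  have "(\<chi> j. r $ i * y $ j) = r $ i *\<^sub>R y" for i
    by (simp add: vec_eq_iff)
  then have "norm ((\<chi> i j. r $ i * y $ j) :: real^'n^'m) = L2_set (\<lambda>i. norm (r $ i) * norm y) UNIV"
    by (simp add: norm_vec_def[where 'b = 'm] L2_set_def power_mult_distrib)
  then show ?thesis by (simp add: norm_vec_def[where 'b = 'm] L2_set_left_distrib)
qed

lemma outer_product_mult: "((\<chi> i j. r $ i * y $ j) :: real^'n^'m) *v v = (y \<bullet> v) *\<^sub>R r"
  by (simp add: vec_eq_iff matrix_vector_mult_def inner_vec_def sum_distrib_left mult_ac)

text \<open>
  With \<open>s = D z\<close> split \<open>D = s z\<^sup>T / \<bar>z\<bar>\<^sup>2 + D\<^sub>1\<close>, where \<open>D\<^sub>1 z = 0\<close>. The vector is then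
  \<open>D\<^sub>1\<^sup>T M z\<close> plus the component of \<open>M\<^sup>T s\<close> orthogonal to \<open>z\<close>, and the squares of
  \<open>\<bar>s\<bar> / \<bar>z\<bar>\<close> and \<open>\<bar>D\<^sub>1\<bar>\<close> add up to that of \<open>\<bar>D\<bar>\<close>.
\<close>

lemma gram_perturbation_bound:
  fixes M D :: "real^'p^'m"
  assumes z: "z \<noteq> 0" and Mz: "(norm (M *v z))\<^sup>2 \<le> \<mu> * (norm z)\<^sup>2"
    and M: "\<And>v. norm (M *v v) \<le> c * norm v"
  defines "w \<equiv> transpose M *v (D *v z) + transpose D *v (M *v z)
      - (2 * ((M *v z) \<bullet> (D *v z)) / (norm z)\<^sup>2) *\<^sub>R z"
  shows "norm w \<le> norm z * sqrt (c\<^sup>2 + \<mu>) * norm D"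
proof -
  define s where "s = D *v z"
  define r where "r = M *v z"
  define a where "a = inverse ((norm z)\<^sup>2)"
  define S :: "real^'p^'m" where "S = (\<chi> i j. (a *\<^sub>R s) $ i * z $ j)"
  define D1 where "D1 = D - S"
  have zz: "z \<bullet> z > 0" "norm z > 0" using z by auto
  have a: "a * (norm z)\<^sup>2 = 1" using z by (simp add: a_def)
  have "\<mu> \<ge> 0"
    using order_trans[OF zero_le_power2 Mz] zz by (simp add: zero_le_mult_iff power2_norm_eq_inner)
  \<comment> \<open>With \<open>X = S\<close> and \<open>X = D\<close> the right side is the same,
    since both send \<open>z\<close> to \<open>s\<close>. So \<open>S\<close> is orthogonal to
    \<open>D1\<close>, and \<open>nD\<close> is Pythagoras.\<close>
  have SD: "S \<bullet> X = a * (s \<bullet> (X *v z))" for X :: "real^'p^'m"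
    by (simp add: S_def inner_vec_def matrix_vector_mult_def sum_distrib_left mult_ac)
  have Sz: "S *v z = s"
    unfolding S_def outer_product_mult using a by (simp add: power2_norm_eq_inner mult.commute)
  have nD: "(norm D)\<^sup>2 = a * (norm s)\<^sup>2 + (norm D1)\<^sup>2"
  proof -
    have "S \<bullet> S = a * (s \<bullet> s)" "S \<bullet> D = a * (s \<bullet> s)"
      by (simp_all add: SD Sz s_def)
    then show ?thesis
      by (simp add: D1_def power2_norm_eq_inner inner_diff_left inner_diff_right inner_commute)
  qed
  have tS: "transpose S *v r = (a * (s \<bullet> r)) *\<^sub>R z"
    by (simp add: vec_eq_iff S_def transpose_def matrix_vector_mult_def inner_vec_def
        sum_distrib_left sum_distrib_right mult_ac)
  define q where "q = transpose M *v s - (a * (s \<bullet> r)) *\<^sub>R z"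
  have D: "D = D1 + S" by (simp add: D1_def)
  have tD: "transpose D *v r = transpose D1 *v r + (a * (s \<bullet> r)) *\<^sub>R z"
    unfolding D using tS
    by (simp add: vec_eq_iff transpose_def matrix_vector_mult_def distrib_right sum.distrib)
  \<comment> \<open>Of the two copies of \<open>k *\<^sub>R z\<close> that are subtracted, one
    cancels \<open>transpose S *v r\<close> and the other projects \<open>transpose M *v s\<close>
    onto the complement of \<open>z\<close>.\<close>
  have w: "w = q + transpose D1 *v r"
  proof -
    define k where "k = a * (s \<bullet> r)"
    have k: "2 * (r \<bullet> s) / (norm z)\<^sup>2 = k + k"
      by (simp add: k_def a_def inner_commute[of s r] divide_inverse)
    have grp: "x + (y + k *\<^sub>R u) - (k + k) *\<^sub>R u = x - k *\<^sub>R u + y" for x y u :: "real^'p"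
      by (simp add: vec_eq_iff distrib_right)
    have "w = transpose M *v s + transpose D *v r - (2 * (r \<bullet> s) / (norm z)\<^sup>2) *\<^sub>R z"
      by (simp only: w_def s_def r_def)
    also have "\<dots> = q + transpose D1 *v r"
      by (simp only: k tD q_def k_def[symmetric] grp)
    finally show ?thesis .
  qed
  have nq: "norm q \<le> c * norm s"
  proof -
    have "q \<bullet> z = s \<bullet> r - (s \<bullet> r) * (a * (norm z)\<^sup>2)"
      unfolding q_def inner_diff_left inner_transpose_matrix_vector r_def[symmetric]
      by (simp add: power2_norm_eq_inner)
    then have "q \<bullet> z = 0" by (simp add: a)
    then have "(norm (q + (a * (s \<bullet> r)) *\<^sub>R z))\<^sup>2 = (norm q)\<^sup>2 + (norm ((a * (s \<bullet> r)) *\<^sub>R z))\<^sup>2"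
      by (intro norm_add_Pythagorean) (simp add: orthogonal_def)
    moreover have "q + (a * (s \<bullet> r)) *\<^sub>R z = transpose M *v s"
      unfolding q_def by (rule diff_add_cancel)
    ultimately have "(norm q)\<^sup>2 \<le> (norm (transpose M *v s))\<^sup>2"
      by (simp del: transpose_matrix_vector)
    then have "norm q \<le> norm (transpose M *v s)"
      by (rule power2_le_imp_le) simp
    then show ?thesis using norm_transpose_matrix_vector_le[OF M, of s] by linarith
  qed
  have n1: "norm (transpose D1 *v r) \<le> norm D1 * (sqrt \<mu> * norm z)"
  proof -
    have "norm r \<le> sqrt \<mu> * norm z"
      using Mz \<open>\<mu> \<ge> 0\<close> by - (rule power2_le_imp_le, simp_all add: r_def power_mult_distrib)
    moreover have "norm (transpose D1 *v r) \<le> norm D1 * norm r"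
      by (rule norm_transpose_matrix_vector_le) (rule norm_matrix_vector_le)
    ultimately show ?thesis by (meson mult_left_mono norm_ge_zero order_trans)
  qed
  have "norm w \<le> c * norm s + sqrt \<mu> * (norm z * norm D1)"
    using norm_triangle_ineq[of q "transpose D1 *v r"] nq n1 unfolding w by (simp add: mult_ac)
  \<comment> \<open>Cauchy-Schwarz in the plane merges both contributions; adding the two bounds
    separately would lose the square root of the sum.\<close>
  also have "\<dots> = (c, sqrt \<mu>) \<bullet> (norm s, norm z * norm D1)" by simp
  also have "\<dots> \<le> norm (c, sqrt \<mu>) * norm (norm s, norm z * norm D1)"
    by (rule norm_cauchy_schwarz)
  also have "norm (c, sqrt \<mu>) = sqrt (c\<^sup>2 + \<mu>)"
    using \<open>\<mu> \<ge> 0\<close> by (simp add: norm_Pair)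
  also have "norm (norm s, norm z * norm D1) = norm z * norm D"
  proof -
    have "(norm s)\<^sup>2 + (norm z * norm D1)\<^sup>2 = (norm z)\<^sup>2 * (a * (norm s)\<^sup>2 + (norm D1)\<^sup>2)"
      using a by (simp add: algebra_simps power_mult_distrib)
    also have "\<dots> = (norm z * norm D)\<^sup>2" by (simp add: nD power_mult_distrib)
    finally show ?thesis by (simp add: norm_Pair)
  qed
  finally show ?thesis by (simp add: mult_ac)
qed

section \<open>The total least squares solution\<close>

lemma coercive_matrix_bound:
  fixes P :: "real^'n^'n"
  assumes "\<And>u. c * (norm u)\<^sup>2 \<le> u \<bullet> (P *v u)"
  shows "c * norm u \<le> norm (P *v u)"
proof (cases "u = 0")
  case False
  have "(c * norm u) * norm u \<le> norm u * norm (P *v u)"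
    using assms[of u] norm_cauchy_schwarz[of u "P *v u"] by (simp add: power2_eq_square)
  then show ?thesis using False by (simp add: mult.commute)
qed simp

lemma bounded_below_invertible:
  fixes P :: "real^'n^'n"
  assumes "c > 0" "\<And>u. c * norm u \<le> norm (P *v u)"
  shows "invertible P"
proof -
  have "u = 0" if "P *v u = 0" for u
    using assms(2)[of u] that \<open>c > 0\<close> by (simp add: mult_le_0_iff)
  then show ?thesis
    by (metis invertible_left_inverse matrix_left_invertible_ker)
qed

lemma matrix_inv_mult_vector:
  fixes P :: "real^'n^'n"
  assumes "invertible P"
  shows "matrix_inv P *v (P *v u) = u" and "P *v (matrix_inv P *v u) = u"
proof -
  have "P ** matrix_inv P = mat 1 \<and> matrix_inv P ** P = mat 1"
    unfolding matrix_inv_def by (rule someI_ex) (use assms in \<open>simp add: invertible_def\<close>)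
  then show "matrix_inv P *v (P *v u) = u" "P *v (matrix_inv P *v u) = u"
    by (simp_all add: matrix_vector_mul_assoc)
qed

definition shifted_gram :: "real^'n^'m \<Rightarrow> real^'m \<Rightarrow> real^'n^'n" where
  "shifted_gram A b = transpose A ** A - tls_lambda A b *\<^sub>R mat 1"

text \<open>The closed formula for the solution. It is informative only under a gap condition, as
  \<open>matrix_inv\<close> of a singular matrix is an arbitrary choice.\<close>

definition tls_point :: "real^'n^'m \<Rightarrow> real^'m \<Rightarrow> real^'n" where
  "tls_point A b = matrix_inv (shifted_gram A b) *v (transpose A *v b)"

lemma shifted_gram_mult:
  "shifted_gram A b *v u = transpose A *v (A *v u) - tls_lambda A b *\<^sub>R u"
  unfolding shifted_gram_def matrix_vector_mult_diff_rdistrib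
    scaleR_matrix_vector_assoc[symmetric] matrix_vector_mul_lid matrix_vector_mul_assoc ..

lemma tls_lambda_nonneg: "0 \<le> tls_lambda A b"
  unfolding tls_lambda_def by (rule gram_min_eigenvalue)

lemma tls_lambda_le: "tls_lambda A b * (norm z)\<^sup>2 \<le> (norm (augment A b *v z))\<^sup>2"
  unfolding tls_lambda_def by (rule gram_min_eigenvalue)

lemma tls_lambda_eigenvector:
  obtains z where "z \<noteq> 0"
    "transpose (augment A b) *v (augment A b *v z) = tls_lambda A b *\<^sub>R z"
proof -
  have "tls_lambda A b \<in> real_eigenvalues (transpose (augment A b) ** augment A b)"
    unfolding tls_lambda_def by (rule gram_min_eigenvalue)
  then show thesis
    using that unfolding real_eigenvalues_def matrix_vector_mul_assoc by blast
qed

text \<open>The smallest singular value is 1-Lipschitz: the minimizing eigenvector at (A, b) serves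
  as test vector at (A', b').\<close>

lemma sqrt_tls_lambda_le:
  "sqrt (tls_lambda A' b') \<le> sqrt (tls_lambda A b) + norm ((A', b') - (A, b))"
proof -
  obtain z where z: "z \<noteq> 0"
    "transpose (augment A b) *v (augment A b *v z) = tls_lambda A b *\<^sub>R z"
    by (rule tls_lambda_eigenvector)
  have root: "sqrt (l * (norm z)\<^sup>2) = sqrt l * norm z" for l
    by (simp add: real_sqrt_mult)
  have "(norm (augment A b *v z))\<^sup>2 = tls_lambda A b * (norm z)\<^sup>2"
    using inner_transpose_matrix_vector[of "augment A b" "augment A b *v z" z] z(2)
    by (simp add: power2_norm_eq_inner)
  then have 1: "norm (augment A b *v z) = sqrt (tls_lambda A b) * norm z"
    using root by (metis norm_ge_zero real_sqrt_unique)
  have "sqrt (tls_lambda A' b') * norm z \<le> norm (augment A' b' *v z)"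
    using real_sqrt_le_mono[OF tls_lambda_le[of A' b' z]] root by simp
  also have "augment A' b' *v z = augment A b *v z + augment (A' - A) (b' - b) *v z"
    by (simp add: augment_diff[symmetric] matrix_vector_mult_diff_rdistrib)
  also have "norm \<dots> \<le> sqrt (tls_lambda A b) * norm z + norm ((A', b') - (A, b)) * norm z"
    using norm_triangle_ineq norm_matrix_vector_le[of "augment (A' - A) (b' - b)" z]
    unfolding 1[symmetric] norm_augment by (simp add: norm_triangle_mono)
  finally have "sqrt (tls_lambda A' b') * norm z
      \<le> (sqrt (tls_lambda A b) + norm ((A', b') - (A, b))) * norm z"
    by (simp add: distrib_right)
  then show ?thesis using z(1) by simp
qed

lemma inner_shifted_gram: "u \<bullet> (shifted_gram A b *v u) = (norm (A *v u))\<^sup>2 - tls_lambda A b * (norm u)\<^sup>2"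
  unfolding shifted_gram_mult inner_diff_right inner_scaleR_right power2_norm_eq_inner
  by (simp only: inner_commute[of u "transpose A *v _"] inner_transpose_matrix_vector)

text \<open>The assumption, used below as the form of genericity, puts the squared smallest singular
  value of \<open>A\<close> at least \<open>c\<close> above \<lambda>. After the shift,
  \<open>c\<close> is left as coercivity constant.\<close>

lemma shifted_gram_bound:
  assumes "\<And>u. (tls_lambda A b + c) * (norm u)\<^sup>2 \<le> (norm (A *v u))\<^sup>2"
  shows "c * norm u \<le> norm (shifted_gram A b *v u)"
proof (rule coercive_matrix_bound)
  fix u
  show "c * (norm u)\<^sup>2 \<le> u \<bullet> (shifted_gram A b *v u)"
    unfolding inner_shifted_gram using assms[of u] by (simp add: distrib_right)
qed

lemma tls_point_unique:
  assumes "c > 0" "\<And>u. (tls_lambda A b + c) * (norm u)\<^sup>2 \<le> (norm (A *v u))\<^sup>2"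
    and "transpose A *v (A *v x - b) = tls_lambda A b *\<^sub>R x"
  shows "tls_point A b = x"
proof -
  have "shifted_gram A b *v x = transpose A *v b"
    using assms(3) unfolding shifted_gram_mult matrix_vector_mult_diff_distrib
    by (metis add_diff_cancel_left' diff_add_cancel)
  moreover have "invertible (shifted_gram A b)"
    using assms(1) shifted_gram_bound[OF assms(2)] by (rule bounded_below_invertible)
  ultimately show ?thesis
    unfolding tls_point_def by (metis matrix_inv_mult_vector(1))
qed

text \<open>These are the two blocks of the eigenvector equation of the bordered Gram matrix at (x,
  -1).\<close>

lemma tls_point_eigen:
  assumes "c > 0" "\<And>u. (tls_lambda A b + c) * (norm u)\<^sup>2 \<le> (norm (A *v u))\<^sup>2"
  shows "transpose A *v (A *v tls_point A b - b) = tls_lambda A b *\<^sub>R tls_point A b"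
    and "b \<bullet> (A *v tls_point A b - b) = - tls_lambda A b"
proof -
  obtain z where z: "z \<noteq> 0"
    "transpose (augment A b) *v (augment A b *v z) = tls_lambda A b *\<^sub>R z"
    by (rule tls_lambda_eigenvector)
  obtain v t where vt: "z = join v t" by (rule join_cases)
  have v: "transpose A *v (A *v v + t *\<^sub>R b) = tls_lambda A b *\<^sub>R v"
    and t: "b \<bullet> (A *v v + t *\<^sub>R b) = tls_lambda A b * t"
    using z(2) unfolding vt augment_join transpose_augment scaleR_join join_eq_iff by auto
  \<comment> \<open>If the last component vanished, \<open>v\<close> would give the quotient
    \<lambda> already for \<open>A\<close> alone, against the gap.\<close>
  have "t \<noteq> 0"
  proof
    assume "t = 0"
    then have "(norm (A *v v))\<^sup>2 = tls_lambda A b * (norm v)\<^sup>2"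
      using v inner_transpose_matrix_vector[of A "A *v v" v]
      by (simp add: power2_norm_eq_inner)
    with assms(2)[of v] have "c * (norm v)\<^sup>2 \<le> 0" by (simp add: distrib_right)
    then have "v = 0" using \<open>c > 0\<close> by (simp add: mult_le_0_iff)
    with \<open>t = 0\<close> z(1) vt show False by (simp add: join_eq_0_iff)
  qed
  define x where "x = (- 1 / t) *\<^sub>R v"
  have r: "A *v x - b = (- 1 / t) *\<^sub>R (A *v v + t *\<^sub>R b)"
    unfolding x_def matrix_vector_mult_scaleR scaleR_add_right using \<open>t \<noteq> 0\<close> by simp
  have 1: "transpose A *v (A *v x - b) = tls_lambda A b *\<^sub>R x"
    unfolding r matrix_vector_mult_scaleR v by (simp add: x_def)
  have 2: "b \<bullet> (A *v x - b) = - tls_lambda A b"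
    unfolding r inner_scaleR_right t using \<open>t \<noteq> 0\<close> by simp
  have "tls_point A b = x"
    using assms 1 by (rule tls_point_unique)
  with 1 2 show "transpose A *v (A *v tls_point A b - b) = tls_lambda A b *\<^sub>R tls_point A b"
    "b \<bullet> (A *v tls_point A b - b) = - tls_lambda A b" by simp_all
qed

text \<open>Pairs the eigenvector equation at (x, -1) with (y, -1). Taking \<open>y = x\<close>
  gives the size of the residual; taking a solution for nearby data gives the increment of
  \<lambda>.\<close>

lemma tls_point_residual:
  fixes A :: "real^'n^'m"
  assumes "transpose A *v (A *v x - b) = l *\<^sub>R x" "b \<bullet> (A *v x - b) = - l"
  shows "(A *v x - b) \<bullet> (A *v y - b) = l * (1 + x \<bullet> y)"
proof -
  have "(A *v x - b) \<bullet> (A *v y) = l * (x \<bullet> y)"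
    unfolding inner_transpose_matrix_vector[symmetric] assms(1) by simp
  moreover have "(A *v x - b) \<bullet> b = - l"
    using assms(2) by (simp only: inner_commute)
  ultimately show ?thesis
    unfolding inner_diff_right[of _ "A *v y"] by (simp add: distrib_left)
qed

text \<open>
  The perturbation \<open>- (A y - b) (y, -1)\<^sup>T / \<bar>(y, -1)\<bar>\<^sup>2\<close> makes the system solvable by \<open>y\<close>, and
  no perturbation that does so is smaller. So \<open>x\<close> minimizes the quotient of
  \<open>\<bar>A y - b\<bar>\<^sup>2\<close> and \<open>\<bar>y\<bar>\<^sup>2 + 1\<close>.
\<close>

lemma tls_solution_minimizes:
  assumes "tls_solution A b x"
  shows "(norm (A *v x - b))\<^sup>2 * (1 + (norm y)\<^sup>2) \<le> (norm (A *v y - b))\<^sup>2 * (1 + (norm x)\<^sup>2)"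
proof -
  obtain E e where Ee: "(A + E) *v x = b + e"
    and min: "\<And>E' e' x'. (A + E') *v x' = b + e' \<Longrightarrow> norm (E, e) \<le> norm (E', e')"
    using assms unfolding tls_solution_def by blast
  define r where "r = A *v y - b"
  define a where "a = inverse (1 + (norm y)\<^sup>2)"
  have pos: "1 + (norm v)\<^sup>2 > 0" for v :: "real^'a" using zero_le_power2[of "norm v"] by linarith
  have a: "a * (1 + (norm y)\<^sup>2) = 1" using pos[of y] by (simp add: a_def)
  define E' :: "real^'a^'b" where "E' = (\<chi> i j. (- a *\<^sub>R r) $ i * y $ j)"
  have "(A + E') *v y = A *v y - (a * (norm y)\<^sup>2) *\<^sub>R r"
    unfolding E'_def matrix_vector_mult_add_rdistrib outer_product_mult
    by (simp add: power2_norm_eq_inner mult.commute)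
  also have "\<dots> = b + a *\<^sub>R r"
  proof -
    have "(a * (1 + (norm y)\<^sup>2)) *\<^sub>R r = r" by (simp add: a)
    then have "a *\<^sub>R r + (a * (norm y)\<^sup>2) *\<^sub>R r = A *v y - b"
      by (simp add: distrib_left scaleR_add_left r_def)
    then have "A *v y = (b + a *\<^sub>R r) + (a * (norm y)\<^sup>2) *\<^sub>R r"
      by (simp only: eq_diff_eq add_ac)
    then show ?thesis by (simp only: add_diff_cancel_right')
  qed
  finally have "norm (E, e) \<le> norm (E', a *\<^sub>R r)" by (rule min)
  then have "(norm (E, e))\<^sup>2 \<le> (norm (E', a *\<^sub>R r))\<^sup>2" by simp
  also have "\<dots> = (norm E')\<^sup>2 + (norm (a *\<^sub>R r))\<^sup>2"
    by (simp add: norm_Pair)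
  also have "\<dots> = a\<^sup>2 * (norm r)\<^sup>2 * (1 + (norm y)\<^sup>2)"
    unfolding E'_def norm_outer_product by (simp add: power_mult_distrib distrib_left)
  also have "\<dots> = a * (norm r)\<^sup>2"
    using a by (simp add: power2_eq_square[of a] mult_ac)
  finally have up: "(norm (E, e))\<^sup>2 \<le> a * (norm r)\<^sup>2" .
  \<comment> \<open>By the constraint the residual is, up to sign, the perturbation applied to (x,
    -1), which bounds the cost from below.\<close>
  have "A *v x - b = - (augment E e *v join x (- 1))"
  proof -
    have "(A *v x) $ i + (E *v x) $ i = b $ i + e $ i" for i
      using Ee unfolding matrix_vector_mult_add_rdistrib by (metis vector_add_component)
    then have "(A *v x) $ i - b $ i = e $ i - (E *v x) $ i" for i
      by (smt (verit))
    then show ?thesis by (simp add: vec_eq_iff augment_join)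
  qed
  then have "norm (A *v x - b) \<le> norm (E, e) * norm (join x (- 1))"
    using norm_matrix_vector_le[of "augment E e" "join x (- 1)"] by (simp add: norm_augment)
  then have "(norm (A *v x - b))\<^sup>2 \<le> (norm (E, e) * norm (join x (- 1)))\<^sup>2"
    by (intro power_mono) auto
  also have "\<dots> = (norm (E, e))\<^sup>2 * (1 + (norm x)\<^sup>2)"
    by (simp add: power_mult_distrib norm_join)
  also have "\<dots> \<le> a * (norm r)\<^sup>2 * (1 + (norm x)\<^sup>2)"
    using up pos[of x] by (intro mult_right_mono) auto
  finally have "(norm (A *v x - b))\<^sup>2 * (1 + (norm y)\<^sup>2)
      \<le> a * (norm r)\<^sup>2 * (1 + (norm x)\<^sup>2) * (1 + (norm y)\<^sup>2)"
    using pos[of y] by (intro mult_right_mono) auto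
  also have "\<dots> = (a * (1 + (norm y)\<^sup>2)) * ((norm r)\<^sup>2 * (1 + (norm x)\<^sup>2))"
    by (simp only: mult_ac)
  finally show ?thesis by (simp add: a r_def)
qed

text \<open>Compared with \<open>tls_point\<close>, whose quotient is \<lambda>, the vector (x, -1)
  attains the minimal Rayleigh quotient. It is therefore an eigenvector, and the normal equations
  have only one solution.\<close>

lemma tls_solution_eq_tls_point:
  assumes gen: "c > 0" "\<And>u. (tls_lambda A b + c) * (norm u)\<^sup>2 \<le> (norm (A *v u))\<^sup>2"
    and sol: "tls_solution A b x"
  shows "tls_point A b = x"
proof -
  define y where "y = tls_point A b"
  note eig = tls_point_eigen[OF gen, folded y_def]
  have y: "(norm (A *v y - b))\<^sup>2 = tls_lambda A b * (1 + (norm y)\<^sup>2)"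
    using tls_point_residual[OF eig, of y] by (simp add: power2_norm_eq_inner)
  have pos: "1 + (norm y)\<^sup>2 > 0" using zero_le_power2[of "norm y"] by linarith
  have "(norm (A *v x - b))\<^sup>2 * (1 + (norm y)\<^sup>2)
      \<le> tls_lambda A b * (1 + (norm x)\<^sup>2) * (1 + (norm y)\<^sup>2)"
    using tls_solution_minimizes[OF sol, of y] unfolding y by (simp only: mult_ac)
  then have "(norm (A *v x - b))\<^sup>2 \<le> tls_lambda A b * (1 + (norm x)\<^sup>2)"
    using pos by simp
  then have le: "(norm (augment A b *v join x (- 1)))\<^sup>2 \<le> tls_lambda A b * (norm (join x (- 1)))\<^sup>2"
    by (simp add: augment_join norm_join add.commute)
  have "(transpose (augment A b) ** augment A b) *v join x (- 1) = tls_lambda A b *\<^sub>R join x (- 1)"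
  proof (rule symmetric_min_eigenvector)
    show "tls_lambda A b * (norm v)\<^sup>2 \<le> v \<bullet> ((transpose (augment A b) ** augment A b) *v v)" for v
      using tls_lambda_le[of A b v] unfolding inner_gram power2_norm_eq_inner .
    show "join x (- 1) \<bullet> ((transpose (augment A b) ** augment A b) *v join x (- 1)) =
        tls_lambda A b * (norm (join x (- 1)))\<^sup>2"
      using le tls_lambda_le[of A b "join x (- 1)"] unfolding inner_gram power2_norm_eq_inner
      by (rule antisym)
  qed (rule gram_symmetric)
  then have "transpose A *v (A *v x - b) = tls_lambda A b *\<^sub>R x"
    unfolding matrix_vector_mul_assoc[symmetric] augment_join transpose_augment scaleR_join join_eq_iff
    by simp
  then show ?thesis using gen tls_point_unique by blast
qed

section \<open>Derivative of the solution map\<close>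

text \<open>Product rule in which the second factor need only be continuous: as the first one
  vanishes at \<open>a\<close>, no difference quotient of \<open>g\<close> enters. This allows
  differentiation of \<lambda> and x from their continuity alone.\<close>

lemma has_derivative_zero_times_continuous:
  assumes prd: "bounded_bilinear prd"
    and f: "(f has_derivative f') (at a within s)" and "f a = 0"
    and g: "(g \<longlongrightarrow> g a) (at a within s)"
  shows "((\<lambda>y. prd (f y) (g y)) has_derivative (\<lambda>h. prd (f' h) (g a))) (at a within s)"
proof (rule has_derivativeI)
  interpret bounded_bilinear prd by (rule prd)
  have lin: "bounded_linear f'" using f by (rule has_derivative_bounded_linear)
  show "bounded_linear (\<lambda>h. prd (f' h) (g a))"
    using bounded_linear_compose[OF bounded_linear_left lin] .
  \<comment> \<open>The error splits into the remainder quotient \<open>d\<close>, which tends to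
    zero, times \<open>g\<close>, and the bounded quotient \<open>e\<close> times the increment of
    \<open>g\<close>.\<close>
  define d where "d y = (f y - f' (y - a)) /\<^sub>R norm (y - a)" for y
  define e where "e y = f' (y - a) /\<^sub>R norm (y - a)" for y
  have split: "((prd (f y) (g y) - prd (f a) (g a)) - prd (f' (y - a)) (g a)) /\<^sub>R norm (y - a)
      = prd (d y) (g y) + prd (e y) (g y - g a)" for y
    by (simp add: d_def e_def \<open>f a = 0\<close> zero_left scaleR_left diff_left diff_right
        scaleR_diff_right)
  have "(d \<longlongrightarrow> 0) (at a within s)"
    using f unfolding has_derivative_at_within by (simp add: d_def[abs_def] \<open>f a = 0\<close>)
  then have 1: "((\<lambda>y. prd (d y) (g y)) \<longlongrightarrow> 0) (at a within s)"
    using tendsto[OF _ g, of d 0] by (simp add: zero_left)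
  obtain B where B: "\<And>x. norm (f' x) \<le> norm x * B"
    using bounded_linear.bounded[OF lin] by blast
  obtain K where K: "K \<ge> 0" "\<And>a b. norm (prd a b) \<le> norm a * norm b * K"
    using nonneg_bounded by blast
  have e: "norm (e y) \<le> \<bar>B\<bar>" for y
  proof (cases "y = a")
    case False
    have "norm (f' (y - a)) \<le> norm (y - a) * \<bar>B\<bar>"
      using B[of "y - a"] mult_left_mono[OF abs_ge_self[of B] norm_ge_zero[of "y - a"]] by linarith
    then show ?thesis using False by (simp add: e_def field_simps)
  qed (simp add: e_def)
  have 2: "((\<lambda>y. prd (e y) (g y - g a)) \<longlongrightarrow> 0) (at a within s)"
  proof (rule Lim_null_comparison)
    have "norm (prd (e y) (g y - g a)) \<le> \<bar>B\<bar> * norm (g y - g a) * K" for y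
      using K(2)[of "e y" "g y - g a"] mult_right_mono[OF mult_right_mono[OF e[of y]] K(1)]
      by (meson norm_ge_zero order_trans)
    then show "\<forall>\<^sub>F y in at a within s. norm (prd (e y) (g y - g a)) \<le> \<bar>B\<bar> * norm (g y - g a) * K"
      by (intro always_eventually allI)
    have "((\<lambda>y. g y - g a) \<longlongrightarrow> 0) (at a within s)"
      using g by (simp add: LIM_zero_iff)
    then show "((\<lambda>y. \<bar>B\<bar> * norm (g y - g a) * K) \<longlongrightarrow> 0) (at a within s)"
      by (intro tendsto_mult_left_zero tendsto_mult_right_zero tendsto_norm_zero)
  qed
  show "((\<lambda>y. ((prd (f y) (g y) - prd (f a) (g a)) - prd (f' (y - a)) (g a)) /\<^sub>R norm (y - a)) \<longlongrightarrow> 0)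
      (at a within s)"
    unfolding split using tendsto_add[OF 1 2] by simp
qed

lemma bounded_bilinear_matrix_vector_mult:
  "bounded_bilinear (\<lambda>(A::real^'n^'m) v. A *v v)"
proof
  show "\<exists>K. \<forall>(A::real^'n^'m) v. norm (A *v v) \<le> norm A * norm v * K"
    by (intro exI[of _ 1]) (simp add: norm_matrix_vector_le)
qed (simp_all add: matrix_vector_mult_add_rdistrib matrix_vector_right_distrib
    scaleR_matrix_vector_assoc matrix_vector_mult_scaleR)

lemma bounded_bilinear_transpose_mult:
  "bounded_bilinear (\<lambda>(A::real^'n^'m) v. transpose A *v v)"
proof
  show "\<exists>K. \<forall>(A::real^'n^'m) v. norm (transpose A *v v) \<le> norm A * norm v * K"
    by (intro exI[of _ 1]) (simp add: norm_transpose_matrix_vector_le norm_matrix_vector_le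
        del: transpose_matrix_vector)
  show "transpose (A + B) *v v = transpose A *v v + transpose B *v v" for A B :: "real^'n^'m" and v
    by (simp add: vec_eq_iff transpose_def matrix_vector_mult_def distrib_right sum.distrib)
  show "transpose (r *\<^sub>R A) *v v = r *\<^sub>R (transpose A *v v)" for A :: "real^'n^'m" and v r
    by (simp add: vec_eq_iff transpose_def matrix_vector_mult_def sum_distrib_left mult.assoc)
qed (simp_all add: matrix_vector_right_distrib matrix_vector_mult_scaleR
    del: transpose_matrix_vector)

text \<open>Here \<open>g\<close> is any positive lower bound for the smallest singular value of
  \<open>A0\<close>. The gap compares singular values, not their squares, because those are
  Lipschitz in the data.\<close>

locale tls_generic =
  fixes A0 :: "real^'n^'m" and b0 :: "real^'m" and g :: real
  assumes gap: "sqrt (tls_lambda A0 b0) < g"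
    and lower: "\<And>u. g * norm u \<le> norm (A0 *v u)"
begin

abbreviation "lam p \<equiv> tls_lambda (fst p) (snd p)"
abbreviation "pt p \<equiv> tls_point (fst p) (snd p)"
abbreviation "res p \<equiv> fst p *v pt p - snd p"
abbreviation "p0 \<equiv> (A0, b0)"
abbreviation "x0 \<equiv> tls_point A0 b0"
abbreviation "r0 \<equiv> A0 *v x0 - b0"
abbreviation "k0 \<equiv> 1 + x0 \<bullet> x0"

text \<open>
  Within distance \<open>eta\<close> of the base point the smallest singular value of \<open>A\<close> is at least
  \<open>g - eta\<close> and that of \<open>[A, b]\<close> is at most \<open>sqrt \<lambda> + eta\<close>, so \<open>delta\<close> is a uniform spectral gap.
\<close>

definition "eta = (g - sqrt (tls_lambda A0 b0)) / 4"
definition "delta = (g - eta)\<^sup>2 - (sqrt (tls_lambda A0 b0) + eta)\<^sup>2"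

lemma eta_pos: "eta > 0"
  using gap by (simp add: eta_def)

lemma delta_pos: "delta > 0"
proof -
  have "sqrt (tls_lambda A0 b0) + eta < g - eta" using gap by (simp add: eta_def field_simps)
  \<comment> \<open>The quarter in \<open>eta\<close> leaves a distance of \<open>2 * eta\<close>,
    half of the original gap, between the two perturbed bounds.\<close>
  moreover have "0 \<le> sqrt (tls_lambda A0 b0) + eta" using eta_pos tls_lambda_nonneg[of A0 b0] by simp
  ultimately show ?thesis unfolding delta_def by (simp add: power_strict_mono)
qed

lemma near_generic:
  assumes "norm (p - p0) < eta"
  shows "(lam p + delta) * (norm u)\<^sup>2 \<le> (norm (fst p *v u))\<^sup>2"
proof -
  have "sqrt (lam p) \<le> sqrt (tls_lambda A0 b0) + eta"
    using sqrt_tls_lambda_le[of "fst p" "snd p" A0 b0] assms by simp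
  then have "(sqrt (lam p))\<^sup>2 \<le> (sqrt (tls_lambda A0 b0) + eta)\<^sup>2"
    by (rule power_mono) (simp add: tls_lambda_nonneg)
  then have l: "lam p + delta \<le> (g - eta)\<^sup>2"
    by (simp add: delta_def tls_lambda_nonneg)
  have "norm (fst p - A0) \<le> eta"
    using norm_fst_le[of "fst (p - p0)" "snd (p - p0)"] assms
    unfolding prod.collapse by simp
  then have "norm ((fst p - A0) *v u) \<le> eta * norm u"
    using norm_matrix_vector_le[of "fst p - A0" u] by (meson mult_right_mono norm_ge_zero order_trans)
  moreover have "norm (A0 *v u) \<le> norm (fst p *v u) + norm ((fst p - A0) *v u)"
    using norm_triangle_ineq4[of "fst p *v u" "(fst p - A0) *v u"]
    by (simp add: matrix_vector_mult_diff_rdistrib)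
  ultimately have "(g - eta) * norm u \<le> norm (fst p *v u)"
    using lower[of u] by (simp add: left_diff_distrib)
  moreover have "4 * eta = g - sqrt (tls_lambda A0 b0)" by (simp add: eta_def)
  then have "g - eta \<ge> 0"
    using eta_pos real_sqrt_ge_zero[OF tls_lambda_nonneg[of A0 b0]] by linarith
  ultimately have "((g - eta) * norm u)\<^sup>2 \<le> (norm (fst p *v u))\<^sup>2"
    by (intro power_mono) auto
  moreover have "(lam p + delta) * (norm u)\<^sup>2 \<le> (g - eta)\<^sup>2 * (norm u)\<^sup>2"
    using l by (rule mult_right_mono) simp
  ultimately show ?thesis by (simp add: power_mult_distrib)
qed

lemma near_eigen:
  assumes "norm (p - p0) < eta"
  shows "transpose (fst p) *v res p = lam p *\<^sub>R pt p" and "snd p \<bullet> res p = - lam p"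
  using tls_point_eigen[OF delta_pos near_generic[OF assms]] by simp_all

lemma base_eigen: "transpose A0 *v r0 = tls_lambda A0 b0 *\<^sub>R x0" "b0 \<bullet> r0 = - tls_lambda A0 b0"
  using near_eigen[of p0] eta_pos by simp_all

section \<open>Continuity of the eigenvalue and the solution at the base point\<close>

lemma eventually_near: "\<forall>\<^sub>F p in at p0. norm (p - p0) < eta"
  using eta_pos by (auto simp: eventually_at dist_norm intro!: exI[of _ eta])

lemma tendsto_lam: "(lam \<longlongrightarrow> tls_lambda A0 b0) (at p0)"
proof -
  have "((\<lambda>p. sqrt (lam p)) \<longlongrightarrow> sqrt (tls_lambda A0 b0)) (at p0)"
  proof (rule LIM_zero_cancel, rule Lim_null_comparison)
    have "norm (sqrt (lam p) - sqrt (tls_lambda A0 b0)) \<le> norm (p - p0)" for p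
      using sqrt_tls_lambda_le[of "fst p" "snd p" A0 b0] sqrt_tls_lambda_le[of A0 b0 "fst p" "snd p"]
      by (simp add: norm_minus_commute abs_le_iff)
    then show "\<forall>\<^sub>F p in at p0. norm (sqrt (lam p) - sqrt (tls_lambda A0 b0)) \<le> norm (p - p0)"
      by (intro always_eventually allI)
    show "((\<lambda>p. norm (p - p0)) \<longlongrightarrow> 0) (at p0)"
      by (intro tendsto_norm_zero LIM_zero tendsto_ident_at)
  qed
  then have "((\<lambda>p. (sqrt (lam p))\<^sup>2) \<longlongrightarrow> (sqrt (tls_lambda A0 b0))\<^sup>2) (at p0)"
    by (rule tendsto_power)
  then show ?thesis by (simp add: tls_lambda_nonneg)
qed

text \<open>The difference \<open>pt p - x0\<close> solves a system whose matrix, taken at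
  \<open>p\<close>, is bounded below by \<open>delta\<close> uniformly near \<open>p0\<close>. Its
  right side \<open>?c p\<close> tends to the defect of the base equation, which is zero.\<close>

lemma tendsto_pt: "(pt \<longlongrightarrow> x0) (at p0)"
proof (rule LIM_zero_cancel, rule Lim_null_comparison)
  let ?c = "\<lambda>p. transpose (fst p) *v (snd p - fst p *v x0) + lam p *\<^sub>R x0"
  show "\<forall>\<^sub>F p in at p0. norm (pt p - x0) \<le> norm (?c p) / delta"
    using eventually_near
  proof eventually_elim
    case (elim p)
    have e: "transpose (fst p) *v (fst p *v pt p) - transpose (fst p) *v snd p = lam p *\<^sub>R pt p"
      using near_eigen(1)[OF elim] by (simp only: matrix_vector_mult_diff_distrib)
    have "shifted_gram (fst p) (snd p) *v (pt p - x0) = ?c p"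
      unfolding shifted_gram_mult matrix_vector_mult_diff_distrib scaleR_diff_right e[symmetric]
      by (simp del: transpose_matrix_vector)
    then have "delta * norm (pt p - x0) \<le> norm (?c p)"
      using shifted_gram_bound[OF near_generic[OF elim], of "pt p - x0"] by simp
    then show ?case using delta_pos by (simp add: field_simps)
  qed
  have "(?c \<longlongrightarrow> transpose A0 *v (b0 - A0 *v x0) + tls_lambda A0 b0 *\<^sub>R x0) (at p0)"
    by (intro tendsto_add bounded_bilinear.tendsto[OF bounded_bilinear_transpose_mult]
        tendsto_diff bounded_bilinear.tendsto[OF bounded_bilinear_matrix_vector_mult]
        tendsto_scaleR tendsto_lam tendsto_const tendsto_eq_intros) auto
  also have "transpose A0 *v (b0 - A0 *v x0) + tls_lambda A0 b0 *\<^sub>R x0 = 0"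
    unfolding base_eigen(1)[symmetric] matrix_vector_mult_diff_distrib by simp
  finally show "((\<lambda>p. norm (?c p) / delta) \<longlongrightarrow> 0) (at p0)"
    by (intro tendsto_divide_zero tendsto_norm_zero)
qed

lemma tendsto_res: "(res \<longlongrightarrow> r0) (at p0)"
  by (intro tendsto_diff bounded_bilinear.tendsto[OF bounded_bilinear_matrix_vector_mult]
      tendsto_pt tendsto_eq_intros) auto

section \<open>First-order expansion of the eigenvalue and the solution\<close>

lemma k0_pos: "k0 > 0"
  using inner_ge_zero[of x0] by linarith

definition "dres h = fst h *v x0 - snd h"

lemma has_derivative_fst_diff: "((\<lambda>p. fst p - A0) has_derivative fst) (at p0)"
  by (auto intro!: derivative_eq_intros)

lemma has_derivative_snd_diff: "((\<lambda>p. snd p - b0) has_derivative snd) (at p0)"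
  by (auto intro!: derivative_eq_intros)

lemma has_derivative_dres: "((\<lambda>p. dres (p - p0)) has_derivative dres) (at p0)"
  unfolding dres_def fst_diff snd_diff fst_conv snd_conv
  by (intro has_derivative_diff has_derivative_snd_diff
      bounded_linear.has_derivative[OF bounded_bilinear.bounded_linear_left[OF bounded_bilinear_matrix_vector_mult]]
      has_derivative_fst_diff)

text \<open>
  \<open>dres\<close> is the change of the residual with \<open>x\<close> frozen at the base point, \<open>dres_pt\<close> the one with \<open>x\<close>
  frozen at the perturbed point. Mixing both makes the increments of \<open>\<lambda>\<close> and \<open>x\<close> exact
  products of a first-order term and a factor that only has to be continuous.
\<close>

definition "dres_pt p = (fst p - A0) *v pt p - (snd p - b0)"

lemma dres_pt_p0: "dres_pt p0 = 0"
  by (simp add: dres_pt_def)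

text \<open>The factor \<open>fst p - A0\<close> vanishes at \<open>p0\<close>, so only the limit
  \<open>x0\<close> of \<open>pt\<close> enters, and the derivative agrees with that of the change
  with x frozen at \<open>x0\<close>.\<close>

lemma has_derivative_dres_pt: "(dres_pt has_derivative dres) (at p0)"
proof -
  have "((\<lambda>p. (fst p - A0) *v pt p) has_derivative (\<lambda>h. fst h *v pt p0)) (at p0)"
    by (intro has_derivative_zero_times_continuous
        [OF bounded_bilinear_matrix_vector_mult has_derivative_fst_diff])
      (simp_all add: tendsto_pt)
  from has_derivative_diff[OF this has_derivative_snd_diff]
  show ?thesis by (simp add: dres_def[abs_def] dres_pt_def[abs_def])
qed

text \<open>The residual identity at \<open>p\<close> tested with \<open>x0\<close> and the one at
  \<open>p0\<close> tested with \<open>pt p\<close> share the factor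
  \<open>1 + x0 \<bullet> pt p\<close>. In their difference the term
  \<open>r0 \<bullet> res p\<close> cancels.\<close>

lemma lam_increment:
  assumes near: "norm (p - p0) < eta" and k: "1 + x0 \<bullet> pt p \<noteq> 0"
  shows "lam p - tls_lambda A0 b0
    = dres (p - p0) \<bullet> (res p /\<^sub>R (1 + x0 \<bullet> pt p)) + dres_pt p \<bullet> (r0 /\<^sub>R (1 + x0 \<bullet> pt p))"
proof -
  have 1: "fst p *v x0 - snd p = r0 + dres (p - p0)"
    by (simp add: dres_def matrix_vector_mult_diff_rdistrib)
  have 2: "A0 *v pt p - b0 = res p - dres_pt p"
    by (simp add: dres_pt_def matrix_vector_mult_diff_rdistrib)
  have "res p \<bullet> (r0 + dres (p - p0)) = lam p * (1 + x0 \<bullet> pt p)"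
    using tls_point_residual[OF near_eigen[OF near], of x0] unfolding 1 inner_commute[of x0] .
  moreover have "r0 \<bullet> (res p - dres_pt p) = tls_lambda A0 b0 * (1 + x0 \<bullet> pt p)"
    using tls_point_residual[OF base_eigen, of "pt p"] unfolding 2 .
  ultimately have "(lam p - tls_lambda A0 b0) * (1 + x0 \<bullet> pt p)
      = dres (p - p0) \<bullet> res p + dres_pt p \<bullet> r0"
    unfolding left_diff_distrib inner_add_right[of "res p"] inner_diff_right[of r0 "res p"]
    using inner_commute[of "res p" r0] inner_commute[of "res p" "dres (p - p0)"]
      inner_commute[of r0 "dres_pt p"] by linarith
  then have "lam p - tls_lambda A0 b0 = (dres (p - p0) \<bullet> res p + dres_pt p \<bullet> r0) / (1 + x0 \<bullet> pt p)"
    by (simp only: nonzero_eq_divide_eq[OF k])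
  then show ?thesis
    unfolding inner_scaleR_right by (simp add: divide_inverse distrib_left mult.commute)
qed

text \<open>Both summands of the increment have the same derivative, whence the factor 2.
  Subtracting the base value makes the function vanish at \<open>p0\<close>, as its later use in the
  product rule requires.\<close>

lemma has_derivative_lam:
  "((\<lambda>p. lam p - tls_lambda A0 b0) has_derivative (\<lambda>h. 2 * (r0 \<bullet> dres h) / k0)) (at p0)"
proof -
  let ?k = "\<lambda>p. 1 + x0 \<bullet> pt p"
  have k: "(?k \<longlongrightarrow> k0) (at p0)"
    by (intro tendsto_add tendsto_inner tendsto_const tendsto_pt)
  have "\<forall>\<^sub>F p in at p0. ?k p \<noteq> 0"
    using k by (rule tendsto_imp_eventually_ne) (use k0_pos in simp)
  then have ev: "\<forall>\<^sub>F p in at p0. dres (p - p0) \<bullet> (res p /\<^sub>R ?k p) + dres_pt p \<bullet> (r0 /\<^sub>R ?k p)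
      = lam p - tls_lambda A0 b0"
    using eventually_near by eventually_elim (rule lam_increment[symmetric])
  have "((\<lambda>p. dres (p - p0) \<bullet> (res p /\<^sub>R ?k p)) has_derivative (\<lambda>h. dres h \<bullet> (res p0 /\<^sub>R ?k p0))) (at p0)"
  proof (rule has_derivative_zero_times_continuous[OF bounded_bilinear_inner has_derivative_dres])
    show "((\<lambda>p. res p /\<^sub>R ?k p) \<longlongrightarrow> res p0 /\<^sub>R ?k p0) (at p0)"
      using k0_pos by (auto intro!: tendsto_scaleR tendsto_inverse k tendsto_res)
  qed (simp add: dres_def)
  moreover have "((\<lambda>p. dres_pt p \<bullet> (r0 /\<^sub>R ?k p)) has_derivative (\<lambda>h. dres h \<bullet> (r0 /\<^sub>R ?k p0))) (at p0)"
  proof (rule has_derivative_zero_times_continuous[OF bounded_bilinear_inner has_derivative_dres_pt])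
    show "((\<lambda>p. r0 /\<^sub>R ?k p) \<longlongrightarrow> r0 /\<^sub>R ?k p0) (at p0)"
      using k0_pos by (auto intro!: tendsto_scaleR tendsto_inverse k)
  qed (rule dres_pt_p0)
  ultimately have "((\<lambda>p. dres (p - p0) \<bullet> (res p /\<^sub>R ?k p) + dres_pt p \<bullet> (r0 /\<^sub>R ?k p)) has_derivative
      (\<lambda>h. dres h \<bullet> (res p0 /\<^sub>R ?k p0) + dres h \<bullet> (r0 /\<^sub>R ?k p0))) (at p0)"
    by (rule has_derivative_add)
  from has_derivative_transform_eventually[OF this ev]
  have "((\<lambda>p. lam p - tls_lambda A0 b0) has_derivative
      (\<lambda>h. dres h \<bullet> (res p0 /\<^sub>R ?k p0) + dres h \<bullet> (r0 /\<^sub>R ?k p0))) (at p0)"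
    by (simp add: dres_def dres_pt_def)
  moreover have "dres h \<bullet> (res p0 /\<^sub>R ?k p0) + dres h \<bullet> (r0 /\<^sub>R ?k p0) = 2 * (r0 \<bullet> dres h) / k0" for h
    by (simp add: inner_commute[of r0] divide_inverse)
  ultimately show ?thesis by simp
qed

text \<open>The matrix on the left is that of the base point, so a fixed inverse applies and only
  the right side has to be differentiated. Each term there contains a factor vanishing at
  \<open>p0\<close>.\<close>

lemma pt_increment:
  assumes near: "norm (p - p0) < eta"
  shows "shifted_gram A0 b0 *v (pt p - x0)
    = (lam p - tls_lambda A0 b0) *\<^sub>R pt p - transpose A0 *v dres_pt p - transpose (fst p - A0) *v res p"
proof -
  have 2: "A0 *v pt p - b0 = res p - dres_pt p"
    by (simp add: dres_pt_def matrix_vector_mult_diff_rdistrib)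
  have "shifted_gram A0 b0 *v (pt p - x0)
      = transpose A0 *v (A0 *v pt p - b0) - transpose A0 *v r0
        - tls_lambda A0 b0 *\<^sub>R pt p + tls_lambda A0 b0 *\<^sub>R x0"
    unfolding shifted_gram_mult matrix_vector_mult_diff_distrib scaleR_diff_right
    by (simp del: transpose_matrix_vector)
  also have "\<dots> = transpose A0 *v res p - transpose A0 *v dres_pt p - tls_lambda A0 b0 *\<^sub>R pt p"
    unfolding base_eigen 2 matrix_vector_mult_diff_distrib[of _ "res p"]
    by (simp del: transpose_matrix_vector)
  \<comment> \<open>Writing the base matrix as the perturbed one minus the increment brings in the
    eigenvector equation at \<open>p\<close>.\<close>
  also have "transpose A0 *v res p = lam p *\<^sub>R pt p - transpose (fst p - A0) *v res p"
    unfolding near_eigen(1)[OF near, symmetric]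
      bounded_bilinear.diff_left[OF bounded_bilinear_transpose_mult]
    by (simp del: transpose_matrix_vector)
  finally show ?thesis
    by (simp del: transpose_matrix_vector add: scaleR_diff_left)
qed

text \<open>The derivative at \<open>p0\<close> of the right side of
  \<open>pt_increment\<close>.\<close>

definition "dpt_rhs h = (2 * (r0 \<bullet> dres h) / k0) *\<^sub>R x0 - transpose A0 *v dres h - transpose (fst h) *v r0"

lemma base_invertible: "invertible (shifted_gram A0 b0)"
  using delta_pos
proof (rule bounded_below_invertible)
  show "delta * norm u \<le> norm (shifted_gram A0 b0 *v u)" for u
    using shifted_gram_bound[OF near_generic[of p0]] eta_pos by simp
qed

lemma has_derivative_pt: "(pt has_derivative (\<lambda>h. matrix_inv (shifted_gram A0 b0) *v dpt_rhs h)) (at p0)"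
proof -
  let ?Q = "\<lambda>p. (lam p - tls_lambda A0 b0) *\<^sub>R pt p - transpose A0 *v dres_pt p
    - transpose (fst p - A0) *v res p"
  have "((\<lambda>p. (lam p - tls_lambda A0 b0) *\<^sub>R pt p) has_derivative
      (\<lambda>h. (2 * (r0 \<bullet> dres h) / k0) *\<^sub>R pt p0)) (at p0)"
    by (rule has_derivative_zero_times_continuous
        [OF bounded_bilinear_scaleR has_derivative_lam]) (simp_all add: tendsto_pt)
  moreover have "((\<lambda>p. transpose A0 *v dres_pt p) has_derivative (\<lambda>h. transpose A0 *v dres h)) (at p0)"
    by (rule bounded_linear.has_derivative[OF matrix_vector_mul_bounded_linear has_derivative_dres_pt])
  moreover have "((\<lambda>p. transpose (fst p - A0) *v res p) has_derivative
      (\<lambda>h. transpose (fst h) *v res p0)) (at p0)"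
    by (rule has_derivative_zero_times_continuous
        [OF bounded_bilinear_transpose_mult has_derivative_fst_diff])
      (simp_all add: tendsto_res)
  ultimately have "(?Q has_derivative (\<lambda>h. (2 * (r0 \<bullet> dres h) / k0) *\<^sub>R pt p0 - transpose A0 *v dres h
      - transpose (fst h) *v res p0)) (at p0)"
    by (intro has_derivative_diff)
  then have "(?Q has_derivative dpt_rhs) (at p0)"
    unfolding dpt_rhs_def[abs_def] fst_conv snd_conv .
  then have "((\<lambda>p. matrix_inv (shifted_gram A0 b0) *v ?Q p + x0) has_derivative
      (\<lambda>h. matrix_inv (shifted_gram A0 b0) *v dpt_rhs h + 0)) (at p0)"
    by (intro has_derivative_add has_derivative_const
        bounded_linear.has_derivative[OF matrix_vector_mul_bounded_linear])
  then have D: "((\<lambda>p. matrix_inv (shifted_gram A0 b0) *v ?Q p + x0) has_derivative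
      (\<lambda>h. matrix_inv (shifted_gram A0 b0) *v dpt_rhs h)) (at p0)"
    by simp
  have eq: "matrix_inv (shifted_gram A0 b0) *v ?Q p + x0 = pt p" if "norm (p - p0) < eta" for p
    unfolding pt_increment[OF that, symmetric] matrix_inv_mult_vector[OF base_invertible]
    by (rule diff_add_cancel)
  show ?thesis
  proof (rule has_derivative_transform_eventually[OF D])
    show "\<forall>\<^sub>F p in at p0. matrix_inv (shifted_gram A0 b0) *v ?Q p + x0 = pt p"
      using eventually_near by eventually_elim (rule eq)
    show "matrix_inv (shifted_gram A0 b0) *v ?Q p0 + x0 = pt p0"
      by (rule eq) (simp add: eta_pos)
  qed simp
qed

text \<open>Up to sign, \<open>dpt_rhs h\<close> is the first block of the vector in
  \<open>gram_perturbation_bound\<close> for z = (x0, -1); dropping the last component does not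
  increase the norm.\<close>

lemma norm_dpt_rhs_le:
  assumes c: "\<And>v. norm (augment A0 b0 *v v) \<le> c * norm v"
  shows "norm (dpt_rhs h) \<le> sqrt (1 + (norm x0)\<^sup>2) * sqrt (c\<^sup>2 + tls_lambda A0 b0) * norm h"
proof -
  define z where "z = join x0 (- 1)"
  define M where "M = augment A0 b0"
  define D where "D = augment (fst h) (snd h)"
  have Mz: "M *v z = r0" by (simp add: M_def z_def augment_join)
  have Dz: "D *v z = dres h" by (simp add: D_def z_def augment_join dres_def)
  have nz: "(norm z)\<^sup>2 = k0" unfolding z_def norm_join by (simp add: power2_norm_eq_inner)
  have "(norm (M *v z))\<^sup>2 \<le> tls_lambda A0 b0 * (norm z)\<^sup>2"
    using tls_point_residual[OF base_eigen, of x0] unfolding Mz nz power2_norm_eq_inner[of r0] by simp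
  moreover have "z \<noteq> 0" by (simp add: z_def join_eq_0_iff)
  ultimately have "norm (transpose M *v dres h + transpose D *v r0 - (2 * (r0 \<bullet> dres h) / k0) *\<^sub>R z)
      \<le> norm z * sqrt (c\<^sup>2 + tls_lambda A0 b0) * norm D"
    using gram_perturbation_bound[of z M "tls_lambda A0 b0" c D] c
    unfolding Mz Dz nz M_def[symmetric] by blast
  moreover have "norm D = norm h" by (simp add: D_def norm_augment)
  moreover have "norm z = sqrt (1 + (norm x0)\<^sup>2)"
    using nz by (metis norm_ge_zero power2_norm_eq_inner real_sqrt_unique)
  moreover have "norm (dpt_rhs h) \<le> norm (transpose M *v dres h + transpose D *v r0 - (2 * (r0 \<bullet> dres h) / k0) *\<^sub>R z)"
  proof -
    have "transpose M *v dres h + transpose D *v r0 - (2 * (r0 \<bullet> dres h) / k0) *\<^sub>R z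
        = join (- dpt_rhs h) (b0 \<bullet> dres h + snd h \<bullet> r0 - (2 * (r0 \<bullet> dres h) / k0) * - 1)"
      unfolding M_def D_def z_def transpose_augment scaleR_join join_add join_diff join_eq_iff dpt_rhs_def
      by (simp del: transpose_matrix_vector)
    moreover have "norm v \<le> norm (join v t)" for v :: "real^'n" and t
      by (rule power2_le_imp_le) (simp_all add: norm_join)
    ultimately show ?thesis by (metis norm_minus_cancel)
  qed
  ultimately show ?thesis by simp
qed

lemma tls_cond_le:
  assumes c: "\<And>v. norm (augment A0 b0 *v v) \<le> c * norm v"
  shows "tls_cond L A0 b0 \<le> sqrt (1 + (norm x0)\<^sup>2) * onorm (\<lambda>v. L *v v) *
    (sqrt (c\<^sup>2 + tls_lambda A0 b0) / (g\<^sup>2 - tls_lambda A0 b0))"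
proof -
  define X where "X h = matrix_inv (shifted_gram A0 b0) *v dpt_rhs h" for h
  have map_eq: "tls_map L = (\<lambda>p. transpose L *v pt p)"
    by (simp add: tls_map_def tls_point_def shifted_gram_def fun_eq_iff split: prod.split)
  have "(tls_map L has_derivative (\<lambda>h. transpose L *v X h)) (at p0)"
    unfolding map_eq X_def
    by (rule bounded_linear.has_derivative[OF matrix_vector_mul_bounded_linear has_derivative_pt])
  then have D: "frechet_derivative (tls_map L) (at p0) = (\<lambda>h. transpose L *v X h)"
    by (rule frechet_derivative_at[symmetric])
  have "0 \<le> sqrt (tls_lambda A0 b0)" by (simp add: tls_lambda_nonneg)
  then have "g > 0" "(sqrt (tls_lambda A0 b0))\<^sup>2 < g\<^sup>2"
    using gap by (linarith, simp add: power_strict_mono del: real_sqrt_pow2)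
  then have pos: "g\<^sup>2 - tls_lambda A0 b0 > 0" by (simp add: tls_lambda_nonneg)
  have X: "norm (X h) \<le> sqrt (1 + (norm x0)\<^sup>2) * sqrt (c\<^sup>2 + tls_lambda A0 b0) * norm h
      / (g\<^sup>2 - tls_lambda A0 b0)" for h
  proof -
    \<comment> \<open>At the base point itself the full gap is available in place of the smaller
      uniform \<open>delta\<close>, which gives the stated denominator.\<close>
    have "(g\<^sup>2 - tls_lambda A0 b0) * norm (X h) \<le> norm (shifted_gram A0 b0 *v X h)"
    proof (rule shifted_gram_bound)
      fix u
      have "(g * norm u)\<^sup>2 \<le> (norm (A0 *v u))\<^sup>2"
        using lower[of u] \<open>g > 0\<close> by (intro power_mono) auto
      then show "(tls_lambda A0 b0 + (g\<^sup>2 - tls_lambda A0 b0)) * (norm u)\<^sup>2 \<le> (norm (A0 *v u))\<^sup>2"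
        by (simp add: power_mult_distrib)
    qed
    also have "shifted_gram A0 b0 *v X h = dpt_rhs h"
      unfolding X_def by (rule matrix_inv_mult_vector(2)[OF base_invertible])
    also note norm_dpt_rhs_le[OF c]
    finally show ?thesis using pos by (simp add: field_simps)
  qed
  have onorm: "norm (L *v v) \<le> onorm (\<lambda>v. L *v v) * norm v" for v
    by (rule onorm) simp
  have nonneg: "0 \<le> onorm (\<lambda>v. L *v v)" by (rule onorm_pos_le) simp
  show ?thesis
    unfolding tls_cond_def D
  proof (rule cSUP_least)
    show "{d :: (real^'n^'m) \<times> (real^'m). d \<noteq> 0} \<noteq> {}"
    proof -
      have "(0, axis undefined 1) \<in> {d :: (real^'n^'m) \<times> (real^'m). d \<noteq> 0}"
        by (simp add: zero_prod_def axis_eq_0_iff)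
      then show ?thesis by blast
    qed
    fix d :: "(real^'n^'m) \<times> (real^'m)"
    assume "d \<in> {d. d \<noteq> 0}"
    then have d: "norm d > 0" by simp
    have "norm (transpose L *v X d) \<le> onorm (\<lambda>v. L *v v) * norm (X d)"
      by (rule norm_transpose_matrix_vector_le) (rule onorm)
    also have "\<dots> \<le> onorm (\<lambda>v. L *v v) * (sqrt (1 + (norm x0)\<^sup>2) * sqrt (c\<^sup>2 + tls_lambda A0 b0)
        * norm d / (g\<^sup>2 - tls_lambda A0 b0))"
      by (rule mult_left_mono[OF X nonneg])
    finally show "norm (transpose L *v X d) / norm d \<le> sqrt (1 + (norm x0)\<^sup>2) * onorm (\<lambda>v. L *v v) *
        (sqrt (c\<^sup>2 + tls_lambda A0 b0) / (g\<^sup>2 - tls_lambda A0 b0))"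
      using d by (simp add: pos_divide_le_eq mult_ac del: transpose_matrix_vector)
  qed
qed

end

theorem corollary1:
  fixes A :: "real^'n^'m" and b :: "real^'m" and L :: "real^'k^'n"
    and x :: "real^'n" and \<sigma> \<sigma>' :: "nat \<Rightarrow> real"
  assumes "CARD('m) > CARD('n)"
    and "CARD('k) \<le> CARD('n)"
    and "singular_values (augment A b) \<sigma>"
    and "singular_values A \<sigma>'"
    and "\<sigma>' CARD('n) > \<sigma> (CARD('n) + 1)"
    and "tls_solution A b x"
  shows "tls_cond L A b
    \<le> sqrt (1 + (norm x)\<^sup>2) * onorm (\<lambda>v. L *v v) *
        (sqrt ((\<sigma> 1)\<^sup>2 + (\<sigma> (CARD('n) + 1))\<^sup>2)
          / ((\<sigma>' CARD('n))\<^sup>2 - (\<sigma> (CARD('n) + 1))\<^sup>2))"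
proof -
  have lam: "tls_lambda A b = (\<sigma> (CARD('n) + 1))\<^sup>2"
    using singular_values_Min[OF assms(3)] by (simp add: tls_lambda_def)
  \<comment> \<open>The sign is needed to identify the square root of \<lambda> with this singular
    value, so that genericity becomes the \<open>gap\<close> of the locale.\<close>
  have "0 \<le> \<sigma> (CARD('n) + 1)"
    using assms(3) by (simp add: singular_values_def)
  then interpret tls_generic A b "\<sigma>' CARD('n)"
    using assms(5) singular_values_lower[OF assms(4)] by unfold_locales (auto simp: lam)
  have "tls_point A b = x"
  proof (rule tls_solution_eq_tls_point[OF delta_pos _ assms(6)])
    show "(tls_lambda A b + delta) * (norm u)\<^sup>2 \<le> (norm (A *v u))\<^sup>2" for u
      using near_generic[of "(A, b)"] eta_pos by simp
  qed
  then show ?thesis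
    using tls_cond_le[OF singular_values_upper[OF assms(3)], of L] by (simp add: lam)
qed

end
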